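(* Let $\mathcal{M}\subset\mathbb{R}^D$ be a $d$-dimensional linear subspace of $\mathbb{R}^D$ equipped with the Euclidean metric. Let $m_0\in\mathcal{M}$, $r>0$, let $x_1,\dots,x_n\in\mathcal{M}$ be data lying in the ball $\{x\in\mathcal{M}:\|x-m_0\|<r\}$, and let $\bar x=\frac1n\sum_{i=1}^n x_i\in\mathcal{M}$ be their sample (Fréchet) mean. Let $\epsilon>0$ and let $\sigma=2\Delta/\epsilon$ or $\sigma=\Delta/\epsilon$ with $\Delta=2r/n$, where $n$ and $\epsilon$ are such that $\sigma\to0$. Let $\widetilde x_D$ denote the private summary generated from the Laplace distribution over $\mathbb{R}^D$ with footpoint $\bar x$ and scale $\sigma$ (equivalently, the K-norm mechanism with the $\ell_2$ norm), i.e. $\widetilde x_D$ has Lebesgue density on $\mathbb{R}^D$ proportional to $e^{-\|y-\bar x\|/\sigma}$. Then $$\mathrm{E}\,\|\mathcal{P}_{\mathcal{M}}\widetilde x_D-\bar x\|^2=O\!\left(\frac{d\,D\,r^2}{n^2\epsilon^2}\right),$$ where $\mathcal{P}_{\mathcal{M}}$ is the orthogonal projection operator onto $\mathcal{M}$.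
   Context: $\|\cdot\|$ is the Euclidean norm on $\mathbb{R}^D$, and $D$ here denotes the dimension of the ambient space. The quantity $\Delta=2r/n$ is the bound used for the global sensitivity (with respect to Euclidean distance) of the mean of $n$ points in a ball of radius $r$ of a flat space, and $\sigma$ is the rate of the Laplace mechanism calibrated to this sensitivity, so that $\sigma=O(r/(n\epsilon))$. The constant implied by $O(\cdot)$ is absolute. *)

theory Defs
  imports "HOL-Probability.Probability" "HOL-Library.Function_Algebras"
begin

text \<open>
  The constant in the claim must not depend on the dimension of the ambient space, so this
  dimension has to be a bound variable and cannot be a type. We therefore identify the space of
  \<open>n\<close>-tuples of reals with the sequences that vanish from index \<open>n\<close> on. Sequences carry the
  pointwise vector space structure, which makes \<^const>\<open>subspace\<close> and \<^const>\<open>dim\<close> available.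
\<close>

instantiation "fun" :: (type, real_vector) real_vector
begin

definition scaleR_fun :: "real \<Rightarrow> ('a \<Rightarrow> 'b) \<Rightarrow> 'a \<Rightarrow> 'b" where
  "scaleR_fun c f = (\<lambda>x. c *\<^sub>R f x)"

instance
  by standard (simp_all add: scaleR_fun_def fun_eq_iff scaleR_add_right scaleR_add_left)

end

definition Rn :: "nat \<Rightarrow> (nat \<Rightarrow> real) set" where
  "Rn D = {y. \<forall>i\<ge>D. y i = 0}"

definition inner_Rn :: "nat \<Rightarrow> (nat \<Rightarrow> real) \<Rightarrow> (nat \<Rightarrow> real) \<Rightarrow> real" where
  "inner_Rn D y z = (\<Sum>i<D. y i * z i)"

definition norm_Rn :: "nat \<Rightarrow> (nat \<Rightarrow> real) \<Rightarrow> real" where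
  "norm_Rn D y = L2_set y {..<D}"

text \<open>Elements of \<^const>\<open>PiM\<close> over \<open>{..<D}\<close> are \<open>undefined\<close> outside \<open>{..<D}\<close>; the image measure
  replaces these values by zero, so that the result is concentrated on \<^term>\<open>Rn D\<close>.\<close>

definition lborel_Rn :: "nat \<Rightarrow> (nat \<Rightarrow> real) measure" where
  "lborel_Rn D = distr (\<Pi>\<^sub>M i\<in>{..<D}. lborel) borel (\<lambda>y i. if i < D then y i else 0)"

definition laplace_Rn :: "nat \<Rightarrow> (nat \<Rightarrow> real) \<Rightarrow> real \<Rightarrow> (nat \<Rightarrow> real) measure" where
  "laplace_Rn D m s =
     density (lborel_Rn D)
       (\<lambda>y. ennreal (exp (- norm_Rn D (y - m) / s)
                      / (\<integral>z. exp (- norm_Rn D (z - m) / s) \<partial>lborel_Rn D)))"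

definition orth_proj :: "nat \<Rightarrow> (nat \<Rightarrow> real) set \<Rightarrow> (nat \<Rightarrow> real) \<Rightarrow> nat \<Rightarrow> real" where
  "orth_proj D M y = (THE p. p \<in> M \<and> (\<forall>v\<in>M. inner_Rn D (y - p) v = 0))"

definition sample_mean :: "nat \<Rightarrow> (nat \<Rightarrow> nat \<Rightarrow> real) \<Rightarrow> nat \<Rightarrow> real" where
  "sample_mean n x = (1 / real n) *\<^sub>R (\<Sum>i=1..n. x i)"

text \<open>The normalising integral is finite and positive.\<close>

lemma measurable_extend_zero:
  "(\<lambda>y i. if i < D then y i else 0) \<in> (\<Pi>\<^sub>M i\<in>{..<D}. lborel) \<rightarrow>\<^sub>M (borel :: (nat \<Rightarrow> real) measure)"
proof -
  have "(\<lambda>y. if i < D then y i else 0) \<in> borel_measurable (\<Pi>\<^sub>M i\<in>{..<D}. (lborel :: real measure))"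
    for i
    by (cases "i < D") (simp_all, measurable)
  then show ?thesis
    by (rule measurable_coordinatewise_then_product)
qed

lemma measurable_norm_Rn:
  "(\<lambda>y. norm_Rn D (y - m)) \<in> borel_measurable (borel :: (nat \<Rightarrow> real) measure)"
  unfolding norm_Rn_def L2_set_def fun_diff_def by measurable

lemma integrable_exp_neg_abs:
  fixes a l :: real
  assumes "l > 0"
  shows "integrable lborel (\<lambda>t. exp (- \<bar>t - a\<bar> * l))"
proof -
  have 0: "integrable lborel (exponential_density l)"
  proof (rule integrableI_nonneg)
    interpret prob_space "density lborel (exponential_density l)"
      by (rule prob_space_exponential_density[OF assms])
    show "(\<integral>\<^sup>+ x. ennreal (exponential_density l x) \<partial>lborel) < \<infinity>"
      using emeasure_space_1 by (simp add: emeasure_density)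
  qed (use assms in \<open>auto simp: exponential_density_nonneg\<close>)
  have 1: "integrable lborel (\<lambda>t. exponential_density l (- t))"
    using lborel_integrable_real_affine[OF 0, of "-1" 0] by simp
  have "integrable lborel (\<lambda>t. (exponential_density l t + exponential_density l (- t)) / l)"
    using 0 1 by simp
  then have "integrable lborel (\<lambda>t. exp (- \<bar>t\<bar> * l))"
    by (rule Bochner_Integration.integrable_bound)
      (use assms in \<open>auto simp: exponential_density_def field_simps\<close>)
  from lborel_integrable_real_affine[OF this, of 1 "- a"] show ?thesis by simp
qed

lemma prob_space_laplace_Rn:
  assumes "s > 0"
  shows "prob_space (laplace_Rn D m s)"
proof -
  let ?P = "\<Pi>\<^sub>M i\<in>{..<D}. (lborel :: real measure)"
  let ?f = "\<lambda>y. exp (- norm_Rn D (y - m) / s)"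
  let ?e = "\<lambda>y i. if i < D then y i else (0::real)"
  let ?Z = "\<integral>z. ?f z \<partial>lborel_Rn D"
  interpret product_sigma_finite "\<lambda>_::nat. lborel :: real measure" by standard
  have f_meas: "?f \<in> borel_measurable borel"
    using measurable_norm_Rn[of D m] by measurable
  have "integrable ?P (\<lambda>y. \<Prod>i<D. exp (- \<bar>y i - m i\<bar> * (1 / (s * real (max 1 D)))))"
    using assms by (intro product_integrable_prod integrable_exp_neg_abs) auto
  then have "integrable ?P (\<lambda>y. ?f (?e y))"
  proof (rule Bochner_Integration.integrable_bound)
    show "(\<lambda>y. ?f (?e y)) \<in> borel_measurable ?P"
      by (rule measurable_compose[OF measurable_extend_zero f_meas])
    show "AE y in ?P. norm (?f (?e y)) \<le> norm (\<Prod>i<D. exp (- \<bar>y i - m i\<bar> * (1 / (s * real (max 1 D)))))"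
    proof (rule AE_I2)
      fix y :: "nat \<Rightarrow> real"
      let ?N = "norm_Rn D (?e y - m)"
      have "\<bar>y i - m i\<bar> \<le> ?N" if "i < D" for i
      proof -
        have "\<bar>(?e y - m) i\<bar> \<le> L2_set (\<lambda>i. \<bar>(?e y - m) i\<bar>) {..<D}"
          using that by (intro member_le_L2_set) auto
        then show ?thesis using that by (simp add: norm_Rn_def L2_set_def)
      qed
      then have "(\<Sum>i<D. \<bar>y i - m i\<bar>) \<le> (\<Sum>i<D. ?N)"
        by (intro sum_mono) auto
      also have "\<dots> \<le> real (max 1 D) * ?N"
        by (simp add: mult_right_mono norm_Rn_def)
      finally have "(\<Sum>i<D. \<bar>y i - m i\<bar>) / (s * real (max 1 D)) \<le> ?N / s"
        using assms by (simp add: field_simps)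
      moreover have "(\<Prod>i<D. exp (- \<bar>y i - m i\<bar> * (1 / (s * real (max 1 D)))))
          = exp (- ((\<Sum>i<D. \<bar>y i - m i\<bar>) / (s * real (max 1 D))))"
        by (simp add: exp_sum[symmetric] sum_negf sum_divide_distrib)
      ultimately show "norm (?f (?e y)) \<le> norm (\<Prod>i<D. exp (- \<bar>y i - m i\<bar> * (1 / (s * real (max 1 D)))))"
        by simp
    qed
  qed
  then have int: "integrable (lborel_Rn D) ?f"
    unfolding lborel_Rn_def
    by (subst integrable_distr_eq[OF measurable_extend_zero f_meas])
  have "emeasure (lborel_Rn D) UNIV = emeasure ?P (space ?P)"
    unfolding lborel_Rn_def
    by (subst emeasure_distr[OF measurable_extend_zero]) auto
  also have "\<dots> = (\<Prod>i<D. \<infinity>)"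
    by (simp add: space_PiM emeasure_PiM)
  also have "\<dots> \<noteq> 0" by simp
  finally have nonnull: "emeasure (lborel_Rn D) UNIV \<noteq> 0" .
  have sp: "space (lborel_Rn D) = UNIV" "sets (lborel_Rn D) = sets borel"
    by (simp_all add: lborel_Rn_def)
  have "?Z \<noteq> 0"
  proof
    assume "?Z = 0"
    then have "AE y in lborel_Rn D. ?f y = 0"
      using integral_nonneg_eq_0_iff_AE[OF int] by simp
    then have "AE y in lborel_Rn D. False" by simp
    then show False using nonnull by (simp add: AE_iff_null sp null_sets_def)
  qed
  moreover have "?Z \<ge> 0" by simp
  ultimately have Z: "?Z > 0" by linarith
  have "emeasure (laplace_Rn D m s) (space (laplace_Rn D m s)) =
      (\<integral>\<^sup>+ y. ennreal (?f y / ?Z) \<partial>lborel_Rn D)"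
    using f_meas unfolding laplace_Rn_def
    by (simp add: emeasure_density sp measurable_cong_sets[OF sp(2) refl])
  also have "\<dots> = ennreal (\<integral> y. ?f y / ?Z \<partial>lborel_Rn D)"
    using int Z by (intro nn_integral_eq_integral) auto
  also have "\<dots> = 1" using Z by simp
  finally show ?thesis by (rule prob_spaceI)
qed

end

theory Submission
  imports Defs
begin

text \<open>
  Choose an orthonormal basis \<open>U\<close> of \<open>M\<close>. As the centre \<open>m\<close> of the noise lies in \<open>M\<close>, Pythagoras
  turns the squared error of the projected point \<open>y\<close> into the sum of the squares of
  \<open>\<langle>y - m, u\<rangle>\<close> over \<open>u \<in> U\<close> (lemma \<open>norm_Rn_orth_proj_diff_squared\<close>). So only the second moment
  of the noise in one direction is needed, and there are at most \<open>d\<close> directions.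

  The noise \<open>Z = y - m\<close> is isotropic, so each of the \<open>D\<close> dimensions receives the same share of
  \<open>E \<parallel>Z\<parallel>\<^sup>2\<close>. Two families of symmetries already force this, and both map the coordinate axes to
  coordinate axes: changing the sign of one coordinate shows that distinct coordinates are
  uncorrelated, and exchanging two coordinates shows that all have the same second moment. Expanding
  the square gives \<open>D * E \<langle>Z, u\<rangle>\<^sup>2 = \<parallel>u\<parallel>\<^sup>2 * E \<parallel>Z\<parallel>\<^sup>2\<close> for every \<open>u\<close>, without a substitution by a
  general rotation (lemma \<open>expectation_inner_squared_laplace_Rn\<close>).

  The radial moment has order \<open>D\<^sup>2 s\<^sup>2\<close> (lemma \<open>expectation_norm_squared_laplace_Rn\<close>). Splitting off
  the fraction \<open>1 / (D + 1)\<close> of the exponent pays for the factor \<open>\<parallel>z\<parallel>\<^sup>2\<close> and costs \<open>2 (D + 1)\<^sup>2 s\<^sup>2\<close>;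
  what remains is the same kernel with \<open>s\<close> enlarged by the factor \<open>1 + 1 / D\<close>, whose integral is
  \<open>(1 + 1 / D)^D \<le> exp 1\<close> times the normalising constant. Hence each direction contributes
  at most \<open>24 D s\<^sup>2\<close>, and \<open>s \<le> 4 r / (n \<epsilon>)\<close> gives the claim with the constant \<open>24 * 16 = 384\<close>.
\<close>

section \<open>Orthonormal bases and orthogonal projections\<close>

lemma norm_Rn_eq_sqrt_inner: "norm_Rn D y = sqrt (inner_Rn D y y)"
  by (simp add: norm_Rn_def inner_Rn_def L2_set_def power2_eq_square)

lemma norm_Rn_squared: "(norm_Rn D y)\<^sup>2 = inner_Rn D y y"
  by (simp add: norm_Rn_eq_sqrt_inner inner_Rn_def sum_nonneg)

lemma inner_Rn_commute: "inner_Rn D y z = inner_Rn D z y"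
  by (simp add: inner_Rn_def mult.commute)

lemma inner_Rn_linear:
  "inner_Rn D (y + y') z = inner_Rn D y z + inner_Rn D y' z"
  "inner_Rn D (y - y') z = inner_Rn D y z - inner_Rn D y' z"
  "inner_Rn D (a *\<^sub>R y) z = a * inner_Rn D y z"
  "inner_Rn D 0 z = 0"
  by (simp_all add: inner_Rn_def scaleR_fun_def sum.distrib sum_subtractf sum_distrib_left
      algebra_simps)

lemma inner_Rn_sum: "inner_Rn D (sum f A) z = (\<Sum>u\<in>A. inner_Rn D (f u) z)"
  by (induction A rule: infinite_finite_induct)
    (simp_all add: inner_Rn_linear del: plus_fun_apply zero_fun_apply)

lemma inner_Rn_self_eq_0_iff: "y \<in> Rn D \<Longrightarrow> inner_Rn D y y = 0 \<longleftrightarrow> y = 0"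
  by (auto simp: inner_Rn_def Rn_def fun_eq_iff sum_nonneg_eq_0_iff) (meson lessThan_iff not_less)

lemma subspace_sum_scaleR:
  fixes M :: "(nat \<Rightarrow> real) set"
  assumes "subspace M" "U \<subseteq> M"
  shows "(\<Sum>u\<in>U. a u *\<^sub>R u) \<in> M"
  using assms by (intro subspace_sum subspace_scale) auto

definition orthonormal_Rn :: "nat \<Rightarrow> (nat \<Rightarrow> real) set \<Rightarrow> bool" where
  "orthonormal_Rn D U \<longleftrightarrow>
     finite U \<and> (\<forall>u\<in>U. \<forall>v\<in>U. inner_Rn D u v = (if u = v then 1 else 0))"

lemma inner_Rn_orthonormal_sum:
  assumes "orthonormal_Rn D U" "v \<in> U"
  shows "inner_Rn D (\<Sum>u\<in>U. a u *\<^sub>R u) v = a v"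
proof -
  have "inner_Rn D (\<Sum>u\<in>U. a u *\<^sub>R u) v = (\<Sum>u\<in>U. a u * inner_Rn D u v)"
    by (simp add: inner_Rn_sum inner_Rn_linear)
  also have "\<dots> = (\<Sum>u\<in>U. if u = v then a v else 0)"
    using assms by (intro sum.cong) (auto simp: orthonormal_Rn_def)
  also have "\<dots> = a v" using assms by (simp add: orthonormal_Rn_def)
  finally show ?thesis .
qed

lemma orthonormal_Rn_independent:
  assumes "orthonormal_Rn D U"
  shows "independent U"
proof (rule independent_if_scalars_zero)
  show "finite U" using assms by (simp add: orthonormal_Rn_def)
  fix f v assume "(\<Sum>u\<in>U. f u *\<^sub>R u) = 0" "v \<in> U"
  then show "f v = 0"
    using inner_Rn_orthonormal_sum[OF assms, of v f] by (simp add: inner_Rn_linear)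
qed

text \<open>The type of sequences has infinite dimension. This lemma is what makes the cardinality
  of a basis of \<open>M\<close>, and hence \<^term>\<open>dim M\<close>, meaningful for subspaces of \<^term>\<open>Rn D\<close>.\<close>

lemma finite_basis_Rn:
  obtains T where "finite T" "Rn D \<subseteq> span T"
proof
  let ?e = "\<lambda>j i. if i = j then 1 else (0::real)"
  show "finite (?e ` {..<D})" by simp
  show "Rn D \<subseteq> span (?e ` {..<D})"
  proof
    fix y assume y: "y \<in> Rn D"
    have app: "sum f A i = (\<Sum>a\<in>A. f a i)" for f :: "nat \<Rightarrow> nat \<Rightarrow> real" and A i
      by (induction A rule: infinite_finite_induct) auto
    have "y = (\<Sum>j<D. y j *\<^sub>R ?e j)"
      using y by (auto simp: fun_eq_iff app scaleR_fun_def Rn_def if_distrib cong: if_cong)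
    also have "\<dots> \<in> span (?e ` {..<D})"
      by (intro span_sum span_scale span_base) auto
    finally show "y \<in> span (?e ` {..<D})" .
  qed
qed

lemma orthonormal_Rn_card_le_dim:
  assumes "M \<subseteq> Rn D" "U \<subseteq> M" "orthonormal_Rn D U"
  shows "card U \<le> dim M"
proof -
  obtain T :: "(nat \<Rightarrow> real) set" where T: "finite T" "Rn D \<subseteq> span T" by (rule finite_basis_Rn)
  obtain B where B: "B \<subseteq> M" "independent B" "M \<subseteq> span B" "card B = dim M"
    by (rule basis_exists)
  have "finite B"
    using independent_span_bound[OF T(1) B(2)] B(1) assms(1) T(2) by blast
  then show ?thesis
    using independent_span_bound[of B U] orthonormal_Rn_independent[OF assms(3)] B assms(2)
    by auto
qed

text \<open>Orthonormal subsets of \<open>M\<close> have at most \<^term>\<open>dim M\<close> elements, so one of them has the largest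
  size. If the residual of some \<open>y \<in> M\<close> after expansion in it were not zero, its normalisation
  could be added to the set.\<close>

lemma orthonormal_basis_exists:
  assumes "M \<subseteq> Rn D" "subspace M"
  obtains U where "U \<subseteq> M" "orthonormal_Rn D U" "card U \<le> dim M"
    "\<forall>y\<in>M. y = (\<Sum>u\<in>U. inner_Rn D y u *\<^sub>R u)"
proof -
  let ?Q = "\<lambda>U. U \<subseteq> M \<and> orthonormal_Rn D U"
  have "?Q {}" by (simp add: orthonormal_Rn_def)
  moreover have "\<forall>V. ?Q V \<longrightarrow> card V < Suc (dim M)"
    using orthonormal_Rn_card_le_dim[OF assms(1)] by (simp add: less_Suc_eq_le)
  ultimately obtain U where U: "?Q U" and max: "\<And>V. ?Q V \<Longrightarrow> card V \<le> card U"
    using ex_has_greatest_nat[of ?Q "{}" card "Suc (dim M)"] by blast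
  have fin: "finite U" using U by (simp add: orthonormal_Rn_def)
  show thesis
  proof (rule that)
    show "U \<subseteq> M" "orthonormal_Rn D U" using U by auto
    then show "card U \<le> dim M" by (rule orthonormal_Rn_card_le_dim[OF assms(1)])
    show "\<forall>y\<in>M. y = (\<Sum>u\<in>U. inner_Rn D y u *\<^sub>R u)"
    proof
      fix y assume y: "y \<in> M"
      let ?p = "\<Sum>u\<in>U. inner_Rn D y u *\<^sub>R u"
      define w where "w = y - ?p"
      define e where "e = (1 / norm_Rn D w) *\<^sub>R w"
      have wM: "w \<in> M"
        using assms(2) U y unfolding w_def by (intro subspace_diff subspace_sum_scaleR) auto
      have ort: "inner_Rn D w u = 0" if "u \<in> U" for u
        using inner_Rn_orthonormal_sum[of D U u] U that by (simp add: w_def inner_Rn_linear)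
      show "y = ?p"
      proof (rule ccontr)
        assume "y \<noteq> ?p"
        then have "w \<noteq> 0" by (simp add: w_def)
        then have "inner_Rn D w w \<noteq> 0"
          using inner_Rn_self_eq_0_iff wM assms(1) by blast
        then have n0: "norm_Rn D w \<noteq> 0" by (simp add: norm_Rn_squared[symmetric])
        have 1: "inner_Rn D e e = 1"
        proof -
          have "inner_Rn D e e = 1 / norm_Rn D w * inner_Rn D e w"
            unfolding e_def by (metis inner_Rn_commute inner_Rn_linear(3))
          also have "inner_Rn D e w = 1 / norm_Rn D w * (norm_Rn D w)\<^sup>2"
            unfolding e_def by (simp only: inner_Rn_linear norm_Rn_squared)
          finally show ?thesis using n0 by (simp add: power2_eq_square)
        qed
        have 2: "inner_Rn D e u = 0" "inner_Rn D u e = 0" if "u \<in> U" for u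
          using ort[OF that] by (simp_all add: e_def inner_Rn_linear inner_Rn_commute[of D u])
        have eM: "e \<in> M" unfolding e_def using assms(2) wM by (rule subspace_scale)
        have "e \<notin> U" using 1 2 by auto
        then have "card (insert e U) > card U" using fin by simp
        moreover have "?Q (insert e U)"
          using U eM 1 2 by (auto simp: orthonormal_Rn_def)
        ultimately show False using max[of "insert e U"] by simp
      qed
    qed
  qed
qed

text \<open>The description of the orthogonal projection as a unique point is justified here for every
  sequence \<open>y\<close>, also outside \<^term>\<open>Rn D\<close>, since the inner product reads only the first \<open>D\<close>
  coordinates.\<close>

lemma orth_proj_eq_orthonormal_expansion:
  assumes M: "M \<subseteq> Rn D" "subspace M" and U: "U \<subseteq> M" "orthonormal_Rn D U"
    and span: "\<forall>y\<in>M. y = (\<Sum>u\<in>U. inner_Rn D y u *\<^sub>R u)"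
  shows "orth_proj D M y = (\<Sum>u\<in>U. inner_Rn D y u *\<^sub>R u)"
  unfolding orth_proj_def
proof (rule the_equality)
  let ?p = "\<Sum>u\<in>U. inner_Rn D y u *\<^sub>R u"
  have pM: "?p \<in> M" using M U by (intro subspace_sum_scaleR)
  have ortU: "inner_Rn D (y - ?p) u = 0" if "u \<in> U" for u
    using inner_Rn_orthonormal_sum[OF U(2) that] by (simp add: inner_Rn_linear)
  have "inner_Rn D (y - ?p) v = 0" if "v \<in> M" for v
  proof -
    have "inner_Rn D v (y - ?p) = (\<Sum>u\<in>U. inner_Rn D v u * inner_Rn D u (y - ?p))"
      by (subst bspec[OF span that]) (simp only: inner_Rn_sum inner_Rn_linear)
    then show ?thesis
      using ortU by (simp add: inner_Rn_commute[of D _ "y - ?p"])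
  qed
  with pM show p: "?p \<in> M \<and> (\<forall>v\<in>M. inner_Rn D (y - ?p) v = 0)" by blast
  fix q assume q: "q \<in> M \<and> (\<forall>v\<in>M. inner_Rn D (y - q) v = 0)"
  have pq: "?p - q \<in> M" using pM q M by (intro subspace_diff) auto
  then have "inner_Rn D (y - q) (?p - q) - inner_Rn D (y - ?p) (?p - q) = 0"
    using p q by simp
  then have "inner_Rn D (?p - q) (?p - q) = 0"
    by (simp add: inner_Rn_linear)
  then have "?p - q = 0" using pq M inner_Rn_self_eq_0_iff by blast
  then show "q = ?p" by simp
qed

text \<open>Pythagoras: the centre \<open>m\<close> is its own projection, so the error is the projection of
  \<open>y - m\<close>.\<close>

lemma norm_Rn_orth_proj_diff_squared:
  assumes M: "M \<subseteq> Rn D" "subspace M" and U: "U \<subseteq> M" "orthonormal_Rn D U"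
    and span: "\<forall>y\<in>M. y = (\<Sum>u\<in>U. inner_Rn D y u *\<^sub>R u)"
    and m: "m \<in> M"
  shows "(norm_Rn D (orth_proj D M y - m))\<^sup>2 = (\<Sum>u\<in>U. (inner_Rn D (y - m) u)\<^sup>2)"
proof -
  let ?s = "\<Sum>u\<in>U. inner_Rn D (y - m) u *\<^sub>R u"
  have "orth_proj D M y - m = (\<Sum>u\<in>U. inner_Rn D y u *\<^sub>R u) - (\<Sum>u\<in>U. inner_Rn D m u *\<^sub>R u)"
    using orth_proj_eq_orthonormal_expansion[OF M U span] bspec[OF span m] by simp
  also have "\<dots> = ?s"
    by (simp add: sum_subtractf[symmetric] inner_Rn_linear scaleR_left_diff_distrib)
  finally have eq: "orth_proj D M y - m = ?s" .
  have "inner_Rn D ?s ?s = (\<Sum>u\<in>U. inner_Rn D (y - m) u * inner_Rn D u ?s)"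
    by (simp only: inner_Rn_sum inner_Rn_linear)
  also have "\<dots> = (\<Sum>u\<in>U. (inner_Rn D (y - m) u)\<^sup>2)"
    using inner_Rn_orthonormal_sum[OF U(2)]
    by (intro sum.cong) (auto simp: inner_Rn_commute[of D _ ?s] power2_eq_square)
  finally show ?thesis by (simp add: eq norm_Rn_squared)
qed

section \<open>Affine substitutions on the coordinates\<close>

lemma affine_measurable:
  fixes c t :: "nat \<Rightarrow> real"
  shows "(\<lambda>y i. t i + c i * y (\<pi> i)) \<in> (borel :: (nat \<Rightarrow> real) measure) \<rightarrow>\<^sub>M borel"
proof (rule measurable_coordinatewise_then_product)
  fix i
  have "(\<lambda>y::nat \<Rightarrow> real. y (\<pi> i)) \<in> borel_measurable borel"
    by (rule measurable_product_then_coordinatewise) measurable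
  then show "(\<lambda>y. t i + c i * y (\<pi> i)) \<in> borel_measurable (borel :: (nat \<Rightarrow> real) measure)"
    by (intro borel_measurable_add borel_measurable_times borel_measurable_const)
qed

text \<open>Change of variables for translations, dilations, sign changes and permutations of the
  coordinates at once. Such a map pulls a box back to a box, so the one-dimensional rule in each
  coordinate is enough, and no Jacobian in several variables appears. The shift \<open>t\<close> is in
  \<^term>\<open>Rn D\<close> because the measure is concentrated there.\<close>

lemma lborel_Rn_affine:
  fixes c t :: "nat \<Rightarrow> real"
  assumes perm: "\<pi> permutes {..<D}" and c: "\<And>i. i < D \<Longrightarrow> c i \<noteq> 0" and t: "t \<in> Rn D"
  shows "lborel_Rn D =
    density (distr (lborel_Rn D) borel (\<lambda>y i. t i + c i * y (\<pi> i))) (\<lambda>_. ennreal (\<Prod>i<D. \<bar>c i\<bar>))"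
proof -
  let ?P = "\<Pi>\<^sub>M i\<in>{..<D}. (lborel :: real measure)"
  let ?e = "\<lambda>y i. if i < D then y i else (0::real)"
  let ?T = "\<lambda>y i. t i + c i * y (\<pi> i)"
  let ?S = "\<lambda>y. \<lambda>i\<in>{..<D}. t i + c i * y (\<pi> i)"
  let ?k = "\<lambda>_::nat \<Rightarrow> real. ennreal (\<Prod>i<D. \<bar>c i\<bar>)"
  interpret product_sigma_finite "\<lambda>_::nat. lborel :: real measure" by standard
  have pi: "\<pi> i < D \<longleftrightarrow> i < D" for i
    using permutes_in_image[OF perm, of i] by simp
  have S[measurable]: "?S \<in> ?P \<rightarrow>\<^sub>M ?P"
  proof (rule measurable_restrict)
    fix i assume "i \<in> {..<D}"
    then have "(\<lambda>y. y (\<pi> i)) \<in> ?P \<rightarrow>\<^sub>M lborel"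
      using pi by (intro measurable_component_singleton) auto
    then have "(\<lambda>y. y (\<pi> i)) \<in> borel_measurable ?P" by simp
    then have "(\<lambda>y. t i + c i * y (\<pi> i)) \<in> borel_measurable ?P"
      by (intro borel_measurable_add borel_measurable_times borel_measurable_const)
    then show "(\<lambda>y. t i + c i * y (\<pi> i)) \<in> ?P \<rightarrow>\<^sub>M lborel" by simp
  qed
  have "density (distr ?P ?P ?S) ?k = ?P"
  proof (rule PiM_eqI)
    show "sets (density (distr ?P ?P ?S) ?k) = sets ?P" by simp
    fix A :: "nat \<Rightarrow> real set"
    assume A: "\<And>i. i \<in> {..<D} \<Longrightarrow> A i \<in> sets lborel"
    let ?B = "\<lambda>i. (\<lambda>u. t i + c i * u) -` A i"
    define ip where "ip = inv \<pi>"
    have ip: "\<pi> (ip j) = j" "ip (\<pi> j) = j" for j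
      using permutes_inverses[OF perm] by (auto simp: ip_def)
    have ipD: "ip j < D \<longleftrightarrow> j < D" for j
      using pi[of "ip j"] ip by simp
    have B: "?B i \<in> sets lborel" if "i < D" for i
    proof -
      have [measurable]: "A i \<in> sets borel" using A that by auto
      have "(\<lambda>u. t i + c i * u) -` A i \<inter> space borel \<in> sets borel" by measurable
      then show ?thesis by simp
    qed
    \<comment> \<open>Coordinate \<open>j\<close> of the argument is read by coordinate \<open>ip j\<close> of the image.\<close>
    have vim: "?S -` Pi\<^sub>E {..<D} A \<inter> space ?P = Pi\<^sub>E {..<D} (\<lambda>j. ?B (ip j))"
      by (auto simp: space_PiM PiE_iff pi ip ipD) (metis ip ipD lessThan_iff pi)+
    have one: "ennreal \<bar>c i\<bar> * emeasure lborel (?B i) = emeasure lborel (A i)" if i: "i < D" for i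
    proof -
      have "lborel = density (distr lborel borel (\<lambda>u. t i + c i * u)) (\<lambda>_. ennreal \<bar>c i\<bar>)"
        using lborel_real_affine[OF c[OF i], of "t i"] by simp
      then have "emeasure lborel (A i)
          = emeasure (density (distr lborel borel (\<lambda>u. t i + c i * u)) (\<lambda>_. ennreal \<bar>c i\<bar>)) (A i)"
        by simp
      also have "\<dots> = ennreal \<bar>c i\<bar> * emeasure lborel (?B i)"
        using A[of i] i by (simp add: emeasure_density_const emeasure_distr)
      finally show ?thesis by simp
    qed
    have box: "Pi\<^sub>E {..<D} A \<in> sets ?P" using A by (intro sets_PiM_I_finite) auto
    have "emeasure (density (distr ?P ?P ?S) ?k) (Pi\<^sub>E {..<D} A)
        = ennreal (\<Prod>i<D. \<bar>c i\<bar>) * emeasure (distr ?P ?P ?S) (Pi\<^sub>E {..<D} A)"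
      using box by (simp add: emeasure_density_const)
    also have "emeasure (distr ?P ?P ?S) (Pi\<^sub>E {..<D} A) = emeasure ?P (Pi\<^sub>E {..<D} (\<lambda>j. ?B (ip j)))"
      using box by (simp only: emeasure_distr[OF S] vim)
    also have "\<dots> = (\<Prod>j<D. emeasure lborel (?B (ip j)))"
      using B ipD by (intro emeasure_PiM) auto
    also have "\<dots> = (\<Prod>i<D. emeasure lborel (?B i))"
      using prod.permute[OF permutes_inv[OF perm], of "\<lambda>i. emeasure lborel (?B i)"]
      by (simp add: ip_def comp_def)
    also have "ennreal (\<Prod>i<D. \<bar>c i\<bar>) * (\<Prod>i<D. emeasure lborel (?B i))
        = (\<Prod>i<D. ennreal \<bar>c i\<bar> * emeasure lborel (?B i))"
      by (simp add: prod_ennreal[symmetric] prod.distrib)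
    also have "\<dots> = (\<Prod>i<D. emeasure lborel (A i))"
      using one by (intro prod.cong) auto
    finally show "emeasure (density (distr ?P ?P ?S) ?k) (Pi\<^sub>E {..<D} A)
        = (\<Prod>i<D. emeasure lborel (A i))" .
  qed simp
  then have "lborel_Rn D = distr (density (distr ?P ?P ?S) ?k) borel ?e"
    by (simp add: lborel_Rn_def)
  also have "\<dots> = density (distr (distr ?P ?P ?S) borel ?e) ?k"
    by (subst density_distr) (auto simp: measurable_extend_zero)
  also have "distr (distr ?P ?P ?S) borel ?e = distr ?P borel (\<lambda>y. ?T (?e y))"
    using t pi by (subst distr_distr[OF measurable_extend_zero S])
      (auto simp: comp_def fun_eq_iff Rn_def intro!: distr_cong)
  also have "\<dots> = distr (lborel_Rn D) borel ?T"
    unfolding lborel_Rn_def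
    by (subst distr_distr[OF affine_measurable measurable_extend_zero]) (simp add: comp_def)
  finally show ?thesis .
qed

section \<open>Integrals against the Laplace distribution\<close>

lemma abs_coord_le_norm_Rn:
  assumes "i < D" shows "\<bar>y i\<bar> \<le> norm_Rn D y"
proof -
  have "\<bar>y i\<bar> \<le> L2_set (\<lambda>i. \<bar>y i\<bar>) {..<D}"
    using assms by (intro member_le_L2_set) auto
  then show ?thesis by (simp add: norm_Rn_def L2_set_def)
qed

lemma norm_Rn_nonneg: "norm_Rn D y \<ge> 0"
  by (simp add: norm_Rn_def)

lemma measurable_coord [measurable]:
  "(\<lambda>y. y i) \<in> borel_measurable (borel :: (nat \<Rightarrow> real) measure)"
  by (rule measurable_product_then_coordinatewise) measurable

lemma measurable_norm_Rn_0 [measurable]: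
  "norm_Rn D \<in> borel_measurable (borel :: (nat \<Rightarrow> real) measure)"
  using measurable_norm_Rn[of D 0] by simp

lemma space_lborel_Rn [simp]: "space (lborel_Rn D) = UNIV"
  and sets_lborel_Rn [simp, measurable_cong]: "sets (lborel_Rn D) = sets borel"
  by (simp_all add: lborel_Rn_def)

lemma space_laplace_Rn [simp]: "space (laplace_Rn D m s) = UNIV"
  and sets_laplace_Rn [simp, measurable_cong]: "sets (laplace_Rn D m s) = sets borel"
  by (simp_all add: laplace_Rn_def)

lemma
  fixes c t :: "nat \<Rightarrow> real"
  assumes perm: "\<pi> permutes {..<D}" and c: "\<And>i. i < D \<Longrightarrow> c i \<noteq> 0" and t: "t \<in> Rn D"
    and f[measurable]: "f \<in> borel_measurable borel"
  shows integrable_lborel_Rn_affine: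
      "integrable (lborel_Rn D) f \<longleftrightarrow>
        integrable (lborel_Rn D) (\<lambda>y. f (\<lambda>i. t i + c i * y (\<pi> i)) :: real)" (is ?I)
    and integral_lborel_Rn_affine:
      "(\<integral>y. f y \<partial>lborel_Rn D) =
        (\<Prod>i<D. \<bar>c i\<bar>) * (\<integral>y. f (\<lambda>i. t i + c i * y (\<pi> i)) \<partial>lborel_Rn D)" (is ?E)
proof -
  let ?T = "\<lambda>y i. t i + c i * y (\<pi> i)"
  note [measurable] = affine_measurable[of t c \<pi>]
  have T: "?T \<in> measurable (lborel_Rn D) borel" by measurable
  have pos: "(\<Prod>i<D. \<bar>c i\<bar>) > 0" using c by (intro prod_pos) auto
  show ?I
    by (subst lborel_Rn_affine[OF perm c t], simp)
      (use pos c in \<open>auto simp: integrable_density integrable_distr_eq[OF T] less_imp_le\<close>)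
  show ?E
    by (subst lborel_Rn_affine[OF perm c t], simp)
      (use pos in \<open>simp add: integral_density integral_distr[OF T] less_imp_le\<close>)
qed

text \<open>Both facts are implicit in the density having total mass 1: if one of them failed, the
  normalising integral would be 0 (for a kernel that is not integrable, by convention), and
  division by 0 would make the density vanish.\<close>

lemma
  assumes s: "s > 0"
  shows integrable_laplace_kernel:
      "integrable (lborel_Rn D) (\<lambda>y. exp (- norm_Rn D (y - m) / s))" (is ?I)
    and integral_laplace_kernel_pos:
      "(\<integral>y. exp (- norm_Rn D (y - m) / s) \<partial>lborel_Rn D) > 0" (is ?P)
proof -
  let ?f = "\<lambda>y. exp (- norm_Rn D (y - m) / s)"
  let ?Z = "\<integral>y. ?f y \<partial>lborel_Rn D"
  note [measurable] = measurable_norm_Rn[of D m]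
  interpret prob_space "laplace_Rn D m s" by (rule prob_space_laplace_Rn[OF s])
  have 1: "(\<integral>\<^sup>+ y. ennreal (?f y / ?Z) \<partial>lborel_Rn D) = 1"
    using emeasure_space_1 unfolding laplace_Rn_def by (simp add: emeasure_density)
  have "?Z \<noteq> 0"
  proof
    assume "?Z = 0"
    with 1 show False by simp
  qed
  moreover have "?Z \<ge> 0" by simp
  ultimately show ?P by linarith
  then show ?I by (metis not_integrable_integral_eq less_irrefl)
qed

lemma
  assumes s: "s > 0" and g[measurable]: "g \<in> borel_measurable borel"
  shows integrable_laplace_Rn_iff:
      "integrable (laplace_Rn D m s) g \<longleftrightarrow>
        integrable (lborel_Rn D) (\<lambda>y. exp (- norm_Rn D (y - m) / s) * g y :: real)" (is ?I)
    and expectation_laplace_Rn: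
      "(\<integral>y. g y \<partial>laplace_Rn D m s) =
        (\<integral>y. exp (- norm_Rn D (y - m) / s) * g y \<partial>lborel_Rn D)
          / (\<integral>y. exp (- norm_Rn D (y - m) / s) \<partial>lborel_Rn D)" (is ?E)
proof -
  note [measurable] = measurable_norm_Rn[of D m]
  let ?Z = "\<integral>y. exp (- norm_Rn D (y - m) / s) \<partial>lborel_Rn D"
  have Z: "?Z > 0" by (rule integral_laplace_kernel_pos[OF s])
  show ?I
  proof -
    have "integrable (laplace_Rn D m s) g \<longleftrightarrow>
        integrable (lborel_Rn D) (\<lambda>y. inverse ?Z * (exp (- norm_Rn D (y - m) / s) * g y))"
      unfolding laplace_Rn_def using Z
      by (subst integrable_density) (auto simp: less_imp_le divide_inverse mult_ac)
    then show ?thesis using Z by (simp only: integrable_mult_left_iff) auto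
  qed
  show ?E
    unfolding laplace_Rn_def using Z by (subst integral_density) (auto simp: less_imp_le)
qed

text \<open>Invariance of the family of Laplace distributions under translations and signed
  permutations of the coordinates: the image of the distribution centred at \<open>m\<close> is the one centred at
  \<open>m'\<close>. The translations reduce everything to the centre \<open>0\<close>, the other maps are its symmetries.\<close>

lemma
  fixes c t :: "nat \<Rightarrow> real"
  assumes s: "s > 0" and perm: "\<pi> permutes {..<D}" and c: "\<And>i. i < D \<Longrightarrow> \<bar>c i\<bar> = 1"
    and t: "t \<in> Rn D"
    and norm: "\<And>y. norm_Rn D ((\<lambda>i. t i + c i * y (\<pi> i)) - m') = norm_Rn D (y - m)"
    and g[measurable]: "g \<in> borel_measurable borel"
  shows integrable_laplace_Rn_isometry:
      "integrable (laplace_Rn D m' s) g \<longleftrightarrow>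
        integrable (laplace_Rn D m s) (\<lambda>y. g (\<lambda>i. t i + c i * y (\<pi> i)) :: real)" (is ?I)
    and expectation_laplace_Rn_isometry:
      "(\<integral>y. g y \<partial>laplace_Rn D m' s) =
        (\<integral>y. g (\<lambda>i. t i + c i * y (\<pi> i)) \<partial>laplace_Rn D m s)" (is ?E)
proof -
  define T where "T = (\<lambda>y i. t i + c i * y (\<pi> i))"
  have [measurable]: "T \<in> borel_measurable borel"
    unfolding T_def by (rule affine_measurable)
  note [measurable] = measurable_norm_Rn[of D m] measurable_norm_Rn[of D m']
  have c0: "c i \<noteq> 0" if "i < D" for i using c[OF that] by auto
  have p1: "(\<Prod>i<D. \<bar>c i\<bar>) = 1" using c by simp
  have gT: "(\<lambda>y. g (T y)) \<in> borel_measurable borel" by measurable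
  have normT: "norm_Rn D (T y - m') = norm_Rn D (y - m)" for y
    unfolding T_def by (rule norm)
  have aff: "integrable (lborel_Rn D) f \<longleftrightarrow> integrable (lborel_Rn D) (\<lambda>y. f (T y))"
      "(\<integral>y. f y \<partial>lborel_Rn D) = (\<integral>y. f (T y) \<partial>lborel_Rn D)"
    if "f \<in> borel_measurable borel" for f :: "(nat \<Rightarrow> real) \<Rightarrow> real"
    unfolding T_def
    using integrable_lborel_Rn_affine[where c = c, OF perm c0 t that]
      integral_lborel_Rn_affine[where c = c, OF perm c0 t that]
    by (simp_all add: p1)
  have "integrable (laplace_Rn D m' s) g \<longleftrightarrow> integrable (laplace_Rn D m s) (\<lambda>y. g (T y))"
    unfolding integrable_laplace_Rn_iff[OF s g] integrable_laplace_Rn_iff[OF s gT]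
    by (subst aff) (simp_all add: normT)
  then show ?I unfolding T_def .
  have "(\<integral>y. exp (- norm_Rn D (y - m') / s) * g y \<partial>lborel_Rn D)
      = (\<integral>y. exp (- norm_Rn D (y - m) / s) * g (T y) \<partial>lborel_Rn D)"
    by (subst aff) (simp_all add: normT)
  moreover have "(\<integral>y. exp (- norm_Rn D (y - m') / s) \<partial>lborel_Rn D)
      = (\<integral>y. exp (- norm_Rn D (y - m) / s) \<partial>lborel_Rn D)"
    by (subst aff) (simp_all add: normT)
  ultimately have "(\<integral>y. g y \<partial>laplace_Rn D m' s) = (\<integral>y. g (T y) \<partial>laplace_Rn D m s)"
    unfolding expectation_laplace_Rn[OF s g] expectation_laplace_Rn[OF s gT] by simp
  then show ?E unfolding T_def .
qed

section \<open>Second moments of the Laplace distribution\<close>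

lemma norm_Rn_scale: "c > 0 \<Longrightarrow> norm_Rn D (\<lambda>i. c * y i) = c * norm_Rn D y"
  by (simp add: norm_Rn_def L2_set_right_distrib)

lemma square_times_exp_le:
  fixes x a :: real
  assumes "x \<ge> 0" "a > 0"
  shows "x\<^sup>2 * exp (- x / a) \<le> 2 * a\<^sup>2"
proof -
  have "(x / a)\<^sup>2 / 2 \<le> exp (x / a)"
    using exp_lower_Taylor_quadratic[of "x / a"] assms by (smt (verit) divide_nonneg_pos)
  then have "x\<^sup>2 \<le> 2 * a\<^sup>2 * exp (x / a)"
    using assms by (simp add: field_simps power_divide)
  then have "x\<^sup>2 * exp (- x / a) \<le> 2 * a\<^sup>2 * exp (x / a) * exp (- x / a)"
    by (intro mult_right_mono) auto
  also have "\<dots> = 2 * a\<^sup>2" by (simp add: mult.assoc exp_add[symmetric])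
  finally show ?thesis .
qed

text \<open>Trading a part of the exponential decay for the factor \<open>\<parallel>y\<parallel>\<^sup>2\<close> leaves a wider Laplace kernel,
  whose integral is known by scaling. The kernel is widened by \<open>1 + 1 / D\<close> because the scaling
  cost is the \<open>D\<close>-th power of this factor, which a factor independent of \<open>D\<close> would make unbounded,
  while a factor of smaller order above 1 would leave too little decay to absorb \<open>\<parallel>y\<parallel>\<^sup>2\<close>. This
  choice yields the true order \<open>D\<^sup>2 s\<^sup>2\<close>. The constant 24 comes from \<open>2 (D + 1)\<^sup>2 \<le> 8 D\<^sup>2\<close> and \<open>exp 1 \<le> 3\<close>.\<close>

lemma
  assumes s: "s > 0" and D: "D > 0"
  shows integrable_norm_squared_laplace_Rn:
      "integrable (laplace_Rn D 0 s) (\<lambda>y. (norm_Rn D y)\<^sup>2)" (is ?I)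
    and expectation_norm_squared_laplace_Rn:
      "(\<integral>y. (norm_Rn D y)\<^sup>2 \<partial>laplace_Rn D 0 s) \<le> 24 * (real D)\<^sup>2 * s\<^sup>2" (is ?E)
proof -
  let ?L = "lborel_Rn D"
  let ?c = "1 + 1 / real D"
  let ?f = "\<lambda>s y. exp (- norm_Rn D y / s)"
  let ?K = "2 * (real D + 1)\<^sup>2 * s\<^sup>2"
  have c: "?c > 0" by (simp add: add_pos_nonneg)
  have cs: "?c * s > 0" using c s by simp
  have int: "integrable ?L (?f s)" "integrable ?L (?f (?c * s))" "(\<integral>y. ?f s y \<partial>?L) > 0"
    using integrable_laplace_kernel[OF s, of D 0] integrable_laplace_kernel[OF cs, of D 0]
      integral_laplace_kernel_pos[OF s, of D 0] by auto
  have bound: "?f s y * (norm_Rn D y)\<^sup>2 \<le> ?K * ?f (?c * s) y" for y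
  proof -
    let ?x = "norm_Rn D y"
    \<comment> \<open>The fractions \<open>1 / (D + 1)\<close> and \<open>D / (D + 1)\<close> of the exponent.\<close>
    have "1 / s = 1 / ((real D + 1) * s) + 1 / (?c * s)"
    proof -
      have "?c = (real D + 1) / real D" using D by (simp add: field_simps)
      then have "1 / (?c * s) = real D / ((real D + 1) * s)" by simp
      then have "1 / ((real D + 1) * s) + 1 / (?c * s) = (real D + 1) / ((real D + 1) * s)"
        by (simp only: add_divide_distrib add.commute)
      also have "\<dots> = 1 / s" by (rule nonzero_divide_mult_cancel_left) simp
      finally show ?thesis by simp
    qed
    then have "- ?x / s = - ?x / ((real D + 1) * s) + - ?x / (?c * s)"
      by (metis (no_types, opaque_lifting) distrib_left times_divide_eq_right mult.right_neutral)
    then have "?f s y * ?x\<^sup>2 = (?x\<^sup>2 * exp (- ?x / ((real D + 1) * s))) * ?f (?c * s) y"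
      by (simp add: exp_add[symmetric])
    also have "\<dots> \<le> (2 * ((real D + 1) * s)\<^sup>2) * ?f (?c * s) y"
      using s by (intro mult_right_mono square_times_exp_le norm_Rn_nonneg) auto
    finally show ?thesis by (simp add: power_mult_distrib mult.assoc)
  qed
  have Kint: "integrable ?L (\<lambda>y. ?K * ?f (?c * s) y)"
    using int by simp
  have I: "integrable ?L (\<lambda>y. ?f s y * (norm_Rn D y)\<^sup>2)"
    by (rule Bochner_Integration.integrable_bound[OF Kint]) (use bound in \<open>auto simp: abs_mult\<close>)
  have m: "(\<lambda>y. (norm_Rn D y)\<^sup>2) \<in> borel_measurable borel" by measurable
  show ?I
    unfolding integrable_laplace_Rn_iff[OF s m] using I by simp
  have scale: "(\<integral>y. ?f (?c * s) y \<partial>?L) = ?c ^ D * (\<integral>y. ?f s y \<partial>?L)"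
  proof -
    have "(\<lambda>y. ?f (?c * s) y) \<in> borel_measurable borel" by measurable
    from integral_lborel_Rn_affine[where t = "\<lambda>_. 0" and c = "\<lambda>_. ?c", OF permutes_id _ _ this] c
    have "(\<integral>y. ?f (?c * s) y \<partial>?L) = ?c ^ D * (\<integral>y. ?f (?c * s) (\<lambda>i. ?c * y i) \<partial>?L)"
      by (simp add: Rn_def)
    moreover have "- norm_Rn D (\<lambda>i. ?c * y i) / (?c * s) = - norm_Rn D y / s" for y
    proof -
      have "?c \<noteq> 0" using c by linarith
      then show ?thesis
        unfolding norm_Rn_scale[OF c] mult_minus_right[symmetric]
        by (rule mult_divide_mult_cancel_left)
    qed
    ultimately show ?thesis by (simp only:)
  qed
  have "?c ^ D \<le> exp (1 / real D) ^ D"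
    using c by (intro power_mono exp_ge_add_one_self) auto
  also have "\<dots> = exp 1" using D by (simp add: exp_of_nat_mult[symmetric])
  also have "\<dots> \<le> 3" by (rule exp_le)
  finally have c3: "?c ^ D \<le> 3" .
  have "(real D + 1)\<^sup>2 \<le> (2 * real D)\<^sup>2" using D by (intro power_mono) auto
  then have D4: "(real D + 1)\<^sup>2 \<le> 4 * (real D)\<^sup>2" by (simp add: power_mult_distrib)
  have "(\<integral>y. ?f s y * (norm_Rn D y)\<^sup>2 \<partial>?L) \<le> (\<integral>y. ?K * ?f (?c * s) y \<partial>?L)"
    by (rule integral_mono[OF I Kint bound])
  also have "\<dots> = (2 * s\<^sup>2) * ((real D + 1)\<^sup>2 * ?c ^ D) * (\<integral>y. ?f s y \<partial>?L)"
    unfolding integral_mult_right_zero scale by (simp only: mult_ac)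
  also have "\<dots> \<le> (2 * s\<^sup>2) * ((4 * (real D)\<^sup>2) * 3) * (\<integral>y. ?f s y \<partial>?L)"
    using int(3) c c3 D4 by (intro mult_right_mono mult_left_mono mult_mono) auto
  finally show ?E
    unfolding expectation_laplace_Rn[OF s m] using int(3) by (simp add: divide_le_eq mult_ac)
qed

lemma norm_Rn_permute:
  "\<pi> permutes {..<D} \<Longrightarrow> norm_Rn D (\<lambda>i. y (\<pi> i)) = norm_Rn D y"
  using sum.permute[of \<pi> "{..<D}" "\<lambda>i. (y i)\<^sup>2"]
  by (simp add: norm_Rn_def L2_set_def comp_def)

lemma norm_Rn_signs:
  assumes "\<And>i. \<bar>c i\<bar> = 1"
  shows "norm_Rn D (\<lambda>i. c i * y i) = norm_Rn D y"
proof -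
  have "(c i)\<^sup>2 = 1" for i using assms[of i] by (metis one_power2 power2_abs)
  then show ?thesis by (simp add: norm_Rn_def L2_set_def power_mult_distrib)
qed

text \<open>The covariance matrix is a multiple of the identity: changing the sign of coordinate \<open>i\<close>
  changes the sign of \<open>y i * y j\<close>, and exchanging \<open>i\<close> and \<open>j\<close> exchanges the two variances.\<close>

lemma
  assumes s: "s > 0"
  shows integrable_coord_product_laplace_Rn:
      "i < D \<Longrightarrow> j < D \<Longrightarrow> integrable (laplace_Rn D 0 s) (\<lambda>y. y i * y j)" (is "_ \<Longrightarrow> _ \<Longrightarrow> ?I")
    and laplace_Rn_coords_uncorrelated:
      "i \<noteq> j \<Longrightarrow> (\<integral>y. y i * y j \<partial>laplace_Rn D 0 s) = 0" (is "_ \<Longrightarrow> ?U")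
    and laplace_Rn_coords_second_moment:
      "i < D \<Longrightarrow> j < D \<Longrightarrow>
        (\<integral>y. (y i)\<^sup>2 \<partial>laplace_Rn D 0 s) = (\<integral>y. (y j)\<^sup>2 \<partial>laplace_Rn D 0 s)" (is "_ \<Longrightarrow> _ \<Longrightarrow> ?S")
proof -
  have m: "(\<lambda>y. y i * y j) \<in> borel_measurable (borel :: (nat \<Rightarrow> real) measure)"
    "(\<lambda>y. (y i)\<^sup>2) \<in> borel_measurable (borel :: (nat \<Rightarrow> real) measure)" by measurable
  show ?I if ij: "i < D" "j < D"
  proof (rule Bochner_Integration.integrable_bound)
    show "integrable (laplace_Rn D 0 s) (\<lambda>y. (norm_Rn D y)\<^sup>2)"
      using ij by (intro integrable_norm_squared_laplace_Rn s) auto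
    have "\<bar>y i * y j\<bar> \<le> norm_Rn D y * norm_Rn D y" for y
      unfolding abs_mult using ij by (intro mult_mono abs_coord_le_norm_Rn norm_Rn_nonneg) auto
    then show "AE y in laplace_Rn D 0 s. norm (y i * y j) \<le> norm ((norm_Rn D y)\<^sup>2)"
      by (simp add: power2_eq_square)
  qed measurable
  show ?U if ij: "i \<noteq> j"
  proof -
    let ?c = "\<lambda>k. if k = i then -1 else (1::real)"
    have "norm_Rn D ((\<lambda>k. 0 + ?c k * y (id k)) - 0) = norm_Rn D (y - 0)" for y
      unfolding diff_0_right add_0 id_apply by (rule norm_Rn_signs) simp
    from expectation_laplace_Rn_isometry[where t = "\<lambda>_. 0" and c = ?c, OF s permutes_id _ _ this m(1)]
    have "(\<integral>y. y i * y j \<partial>laplace_Rn D 0 s)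
        = (\<integral>y. (0 + ?c i * y (id i)) * (0 + ?c j * y (id j)) \<partial>laplace_Rn D 0 s)"
      by (simp add: Rn_def del: zero_fun_apply)
    then show ?thesis using ij by simp
  qed
  show ?S if ij: "i < D" "j < D"
  proof -
    let ?p = "Transposition.transpose i j"
    have p: "?p permutes {..<D}" using ij by (intro permutes_swap_id) auto
    have "norm_Rn D ((\<lambda>k. 0 + 1 * y (?p k)) - 0) = norm_Rn D (y - 0)" for y
      unfolding diff_0_right add_0 mult_1 by (rule norm_Rn_permute[OF p])
    from expectation_laplace_Rn_isometry[where t = "\<lambda>_. 0" and c = "\<lambda>_. 1", OF s p _ _ this m(2)]
    show ?thesis by (simp add: Rn_def del: zero_fun_apply)
  qed
qed

text \<open>Isotropy: the second moment in direction \<open>u\<close> is the quadratic form of the covariance matrix,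
  which is a multiple of the identity with trace \<open>E \<parallel>y\<parallel>\<^sup>2\<close>. The factor \<open>D\<close> is kept on the left so that the
  identity holds for \<open>D = 0\<close> too.\<close>

lemma
  assumes s: "s > 0"
  shows integrable_inner_squared_laplace_Rn:
      "integrable (laplace_Rn D 0 s) (\<lambda>y. (inner_Rn D y u)\<^sup>2)" (is ?I)
    and expectation_inner_squared_laplace_Rn:
      "real D * (\<integral>y. (inner_Rn D y u)\<^sup>2 \<partial>laplace_Rn D 0 s)
        = (norm_Rn D u)\<^sup>2 * (\<integral>y. (norm_Rn D y)\<^sup>2 \<partial>laplace_Rn D 0 s)" (is ?E)
proof -
  let ?\<mu> = "laplace_Rn D 0 s"
  define v where "v = (\<integral>y. (y 0)\<^sup>2 \<partial>?\<mu>)"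
  note ip = integrable_coord_product_laplace_Rn[OF s]
  have expand: "(inner_Rn D y u)\<^sup>2 = (\<Sum>i<D. \<Sum>j<D. u i * u j * (y i * y j))" for y
    by (simp add: inner_Rn_def power2_eq_square sum_product mult_ac)
  have ii: "integrable ?\<mu> (\<lambda>y. u i * u j * (y i * y j))" if "i < D" "j < D" for i j
    using ip[OF that] by simp
  show ?I
    unfolding expand by (intro Bochner_Integration.integrable_sum ii) auto
  have vi: "(\<integral>y. y i * y i \<partial>?\<mu>) = v" if "i < D" for i
    using laplace_Rn_coords_second_moment[OF s that, of 0] that by (simp add: v_def power2_eq_square)
  have "(\<integral>y. (inner_Rn D y u)\<^sup>2 \<partial>?\<mu>)
      = (\<Sum>i<D. \<integral>y. (\<Sum>j<D. u i * u j * (y i * y j)) \<partial>?\<mu>)"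
    unfolding expand
    by (intro Bochner_Integration.integral_sum Bochner_Integration.integrable_sum ii) auto
  also have "\<dots> = (\<Sum>i<D. \<Sum>j<D. \<integral>y. u i * u j * (y i * y j) \<partial>?\<mu>)"
    by (intro sum.cong Bochner_Integration.integral_sum ii) auto
  also have "\<dots> = (\<Sum>i<D. \<Sum>j<D. u i * u j * (\<integral>y. y i * y j \<partial>?\<mu>))"
    by simp
  also have "\<dots> = (\<Sum>i<D. \<Sum>j<D. if i = j then (u i)\<^sup>2 * v else 0)"
    using vi laplace_Rn_coords_uncorrelated[OF s]
    by (intro sum.cong refl) (auto simp: power2_eq_square)
  also have "\<dots> = (norm_Rn D u)\<^sup>2 * v"
    by (simp add: norm_Rn_squared inner_Rn_def sum_distrib_right flip: power2_eq_square)
  finally have 1: "(\<integral>y. (inner_Rn D y u)\<^sup>2 \<partial>?\<mu>) = (norm_Rn D u)\<^sup>2 * v" .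
  have "(\<integral>y. (norm_Rn D y)\<^sup>2 \<partial>?\<mu>) = (\<Sum>i<D. \<integral>y. y i * y i \<partial>?\<mu>)"
    unfolding norm_Rn_squared inner_Rn_def using ip
    by (intro Bochner_Integration.integral_sum) auto
  also have "\<dots> = real D * v" using vi by simp
  finally show ?E using 1 by simp
qed

corollary expectation_inner_squared_laplace_Rn_le:
  assumes s: "s > 0" and u: "norm_Rn D u = 1"
  shows "(\<integral>y. (inner_Rn D y u)\<^sup>2 \<partial>laplace_Rn D 0 s) \<le> 24 * real D * s\<^sup>2"
proof -
  have D: "D > 0" using u by (cases "D = 0") (auto simp: norm_Rn_def)
  have "real D * (\<integral>y. (inner_Rn D y u)\<^sup>2 \<partial>laplace_Rn D 0 s) \<le> 24 * (real D)\<^sup>2 * s\<^sup>2"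
    using expectation_inner_squared_laplace_Rn[OF s, of D u]
      expectation_norm_squared_laplace_Rn[OF s D] u by simp
  also have "\<dots> = real D * (24 * real D * s\<^sup>2)" by (simp add: power2_eq_square)
  finally show ?thesis using D by simp
qed

lemma
  assumes s: "s > 0" and m: "m \<in> Rn D" and u: "norm_Rn D u = 1"
  shows integrable_centred_inner_squared_laplace_Rn:
      "integrable (laplace_Rn D m s) (\<lambda>y. (inner_Rn D (y - m) u)\<^sup>2)" (is ?I)
    and expectation_centred_inner_squared_laplace_Rn_le:
      "(\<integral>y. (inner_Rn D (y - m) u)\<^sup>2 \<partial>laplace_Rn D m s) \<le> 24 * real D * s\<^sup>2" (is ?E)
proof -
  have g: "(\<lambda>y. (inner_Rn D (y - m) u)\<^sup>2) \<in> borel_measurable borel"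
    unfolding inner_Rn_def fun_diff_def
    by (intro borel_measurable_power borel_measurable_sum borel_measurable_times
        borel_measurable_diff measurable_coord borel_measurable_const)
  have eq: "(\<lambda>i. m i + 1 * y (id i)) - m = y" for y by (simp add: fun_eq_iff)
  have nm: "norm_Rn D ((\<lambda>i. m i + 1 * y (id i)) - m) = norm_Rn D (y - 0)" for y
    unfolding eq diff_0_right ..
  note iso = integrable_laplace_Rn_isometry[where t = m and c = "\<lambda>_. 1", OF s permutes_id _ m nm g]
    expectation_laplace_Rn_isometry[where t = m and c = "\<lambda>_. 1", OF s permutes_id _ m nm g]
  show ?I using integrable_inner_squared_laplace_Rn[OF s, of D u] iso(1) unfolding eq
    by (simp del: zero_fun_apply)
  show ?E using expectation_inner_squared_laplace_Rn_le[OF s u] iso(2) unfolding eq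
    by (simp del: zero_fun_apply)
qed

section \<open>The error of the projected summary\<close>

lemma laplace_Rn_projection_error:
  assumes s: "s > 0" and M: "M \<subseteq> Rn D" "subspace M" and m: "m \<in> M"
  shows "integrable (laplace_Rn D m s) (\<lambda>y. (norm_Rn D (orth_proj D M y - m))\<^sup>2) \<and>
    (\<integral>y. (norm_Rn D (orth_proj D M y - m))\<^sup>2 \<partial>laplace_Rn D m s)
      \<le> 24 * real (dim M) * real D * s\<^sup>2"
proof -
  obtain U where U: "U \<subseteq> M" "orthonormal_Rn D U" "card U \<le> dim M"
    and span: "\<forall>y\<in>M. y = (\<Sum>u\<in>U. inner_Rn D y u *\<^sub>R u)"
    by (rule orthonormal_basis_exists[OF M])
  have eq: "(norm_Rn D (orth_proj D M y - m))\<^sup>2 = (\<Sum>u\<in>U. (inner_Rn D (y - m) u)\<^sup>2)" for y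
    by (rule norm_Rn_orth_proj_diff_squared[OF M U(1,2) span m])
  have mR: "m \<in> Rn D" using M m by blast
  have nu: "norm_Rn D u = 1" if "u \<in> U" for u
    using U(2) that by (simp add: norm_Rn_eq_sqrt_inner orthonormal_Rn_def)
  have int: "integrable (laplace_Rn D m s) (\<lambda>y. (inner_Rn D (y - m) u)\<^sup>2)" if "u \<in> U" for u
    by (rule integrable_centred_inner_squared_laplace_Rn[OF s mR nu[OF that]])
  have "(\<integral>y. (\<Sum>u\<in>U. (inner_Rn D (y - m) u)\<^sup>2) \<partial>laplace_Rn D m s)
      = (\<Sum>u\<in>U. \<integral>y. (inner_Rn D (y - m) u)\<^sup>2 \<partial>laplace_Rn D m s)"
    using int by (rule Bochner_Integration.integral_sum)
  also have "\<dots> \<le> (\<Sum>u\<in>U. 24 * real D * s\<^sup>2)"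
    by (intro sum_mono expectation_centred_inner_squared_laplace_Rn_le[OF s mR] nu)
  also have "\<dots> = real (card U) * (24 * real D * s\<^sup>2)" by simp
  also have "\<dots> \<le> real (dim M) * (24 * real D * s\<^sup>2)"
    using U(3) by (intro mult_right_mono) auto
  finally show ?thesis
    unfolding eq using int by (simp add: mult_ac)
qed

lemma sample_mean_mem:
  assumes "subspace M" "\<And>i. i \<in> {1..n} \<Longrightarrow> x i \<in> M"
  shows "sample_mean n x \<in> M"
  unfolding sample_mean_def using assms by (intro subspace_scale subspace_sum) auto

lemma laplace_Rn_projection_error_calibrated:
  assumes M: "M \<subseteq> Rn D" "subspace M" and r: "r > 0" and n: "n \<ge> 1"
    and x: "\<forall>i\<in>{1..n}. x i \<in> M" and \<epsilon>: "\<epsilon> > 0"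
    and \<Delta>: "\<Delta> = 2 * r / real n" and \<sigma>: "\<sigma> = 2 * \<Delta> / \<epsilon> \<or> \<sigma> = \<Delta> / \<epsilon>"
  defines "m \<equiv> sample_mean n x"
  shows "integrable (laplace_Rn D m \<sigma>) (\<lambda>y. (norm_Rn D (orth_proj D M y - m))\<^sup>2) \<and>
    (\<integral>y. (norm_Rn D (orth_proj D M y - m))\<^sup>2 \<partial>laplace_Rn D m \<sigma>)
      \<le> 384 * (real (dim M) * real D * r\<^sup>2 / ((real n)\<^sup>2 * \<epsilon>\<^sup>2))"
proof -
  have \<Delta>0: "\<Delta> > 0" using r n \<Delta> by simp
  then have s: "\<sigma> > 0" using \<sigma> \<epsilon> by auto
  have "\<sigma> \<le> 2 * \<Delta> / \<epsilon>" using \<sigma> \<Delta>0 \<epsilon> by (auto intro!: divide_right_mono)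
  then have "\<sigma>\<^sup>2 \<le> (2 * \<Delta> / \<epsilon>)\<^sup>2" using s by (intro power_mono) auto
  also have "\<dots> = 16 * (r\<^sup>2 / ((real n)\<^sup>2 * \<epsilon>\<^sup>2))"
    by (simp add: \<Delta> power_divide power_mult_distrib)
  finally have "24 * real (dim M) * real D * \<sigma>\<^sup>2
      \<le> 24 * real (dim M) * real D * (16 * (r\<^sup>2 / ((real n)\<^sup>2 * \<epsilon>\<^sup>2)))"
    by (intro mult_left_mono) auto
  also have "\<dots> = 384 * (real (dim M) * real D * r\<^sup>2 / ((real n)\<^sup>2 * \<epsilon>\<^sup>2))" by simp
  finally have bound: "24 * real (dim M) * real D * \<sigma>\<^sup>2
      \<le> 384 * (real (dim M) * real D * r\<^sup>2 / ((real n)\<^sup>2 * \<epsilon>\<^sup>2))" .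
  have "m \<in> M" unfolding m_def using M x by (intro sample_mean_mem) auto
  from laplace_Rn_projection_error[OF s M this] bound show ?thesis by linarith
qed

theorem theorem4:
  shows "\<exists>C>0. \<forall>\<^sub>F \<sigma> in at_right (0::real).
    \<forall>(D::nat) (d::nat) (M::(nat \<Rightarrow> real) set) (m0::nat \<Rightarrow> real) (r::real)
      (n::nat) (x::nat \<Rightarrow> nat \<Rightarrow> real) (\<epsilon>::real) (\<Delta>::real) (xbar::nat \<Rightarrow> real).
      M \<subseteq> Rn D \<longrightarrow> subspace M \<longrightarrow> dim M = d \<longrightarrow>
      m0 \<in> M \<longrightarrow> r > 0 \<longrightarrow> n \<ge> 1 \<longrightarrow>
      (\<forall>i\<in>{1..n}. x i \<in> M \<and> norm_Rn D (x i - m0) < r) \<longrightarrow>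
      xbar = sample_mean n x \<longrightarrow>
      \<epsilon> > 0 \<longrightarrow> \<Delta> = 2 * r / real n \<longrightarrow> (\<sigma> = 2 * \<Delta> / \<epsilon> \<or> \<sigma> = \<Delta> / \<epsilon>) \<longrightarrow>
      integrable (laplace_Rn D xbar \<sigma>) (\<lambda>y. (norm_Rn D (orth_proj D M y - xbar))\<^sup>2) \<and>
      prob_space.expectation (laplace_Rn D xbar \<sigma>) (\<lambda>y. (norm_Rn D (orth_proj D M y - xbar))\<^sup>2)
        \<le> C * (real d * real D * r\<^sup>2 / ((real n)\<^sup>2 * \<epsilon>\<^sup>2))"
  by (rule exI[of _ "384::real"], rule conjI, simp, rule always_eventually)
    (use laplace_Rn_projection_error_calibrated in blast)

end
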